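(* Let $b$ be a fixed integer, fix integer rank levels $1\le r_1<r_2\le b$, let $0<\alpha_1<\alpha_2<1$, and let $s_1=s_1(n)$, $s_2=s_2(n)$ be integers with $s_1=\alpha_1 n+o(n)$ and $s_2=\alpha_2 n+o(n)$ as $n\to\infty$. Let $P^{(n)}_{\rm DLP}(\pi(s,r))$ be the winning probability, with $n$ objects, of the double-level policy $\pi(s,r)$ with $s=(s_1,s_2)$ and $r=(r_1,r_2)$. Then $$\begin{aligned} \lim_{n\to\infty} P_{\rm DLP}^{(n)}(\pi(s,r)) ={}& \alpha_1^{r_1}\int_{\alpha_1}^{\alpha_2}\frac{1}{x^{r_1}}\left( r_1 + \sum_{j=r_1+1}^b\sum_{k=1}^{r_1} \binom{j-1}{k-1}x^{k-1}(1-x)^{j-k}\right)dx\\ & + \alpha_1^{r_1}\alpha_2^{r_2-r_1}\int_{\alpha_2}^{1}\frac{1}{x^{r_2}}\left( r_2 + \sum_{j=r_2+1}^b\sum_{k=1}^{r_2} \binom{j-1}{k-1}x^{k-1}(1-x)^{j-k}\right)dx. \end{aligned}$$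
   Context: $n$ objects (with $n\ge b$) arrive one by one in uniformly random order. $X_i\in\{1,\ldots,n\}$ is the absolute rank of the $i$-th arriving object (rank 1 is best), so $(X_1,\ldots,X_n)$ is a uniformly random permutation of $\{1,\ldots,n\}$. $Y_i=\#\{k\le i: X_k\le X_i\}$ is the relative rank of the $i$-th object among the first $i$ objects. Double-level policy $\pi(s,r)$ with position thresholds $s=(s_1,s_2)$, $r_1\le s_1<s_2\le n-1$, and rank levels $r=(r_1,r_2)$, $1\le r_1<r_2\le b$: no object at positions $1,\ldots,s_1$ is picked; the first object at a position $i\in\{s_1+1,\ldots,s_2\}$ with $Y_i\le r_1$ is picked; if there is none, the first object at a position $i\in\{s_2+1,\ldots,n-1\}$ with $Y_i\le r_2$ is picked; if there is none either, the last object (position $n$) is picked, whatever its rank. The policy wins if the picked object, at position $i$, has $X_i\le b$ (it is one of the $b$ best). $P^{(n)}_{\rm DLP}(\pi(s,r))$ is the probability of winning. Since $0<\alpha_1<\alpha_2<1$, the condition $r_1\le s_1<s_2\le n-1$ holds for all large $n$. Empty sums are zero. *)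

theory Defs
  imports "HOL-Probability.Probability" "HOL-Combinatorics.Permutations"
    "HOL-Library.Landau_Symbols"
begin

text \<open>An arrival order of \<open>n\<close> objects is a permutation \<open>X\<close> of \<open>{1..n}\<close>, where \<open>X i\<close> is the
  absolute rank (1 is best) of the \<open>i\<close>-th arriving object.\<close>

definition rel_rank :: "(nat \<Rightarrow> nat) \<Rightarrow> nat \<Rightarrow> nat" where
  "rel_rank X i = card {k \<in> {1..i}. X k \<le> X i}"

text \<open>Position picked by the double-level policy. The policy is only meaningful for
  \<open>r1 \<le> s1 < s2 \<le> n - 1\<close> and \<open>1 \<le> r1 < r2 \<le> b \<le> n\<close>; outside this range the value is
  arbitrary.\<close>

definition dlp_pick :: "nat \<Rightarrow> nat \<times> nat \<Rightarrow> nat \<times> nat \<Rightarrow> (nat \<Rightarrow> nat) \<Rightarrow> nat" where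
  "dlp_pick n s r X =
    (if \<exists>i\<in>{fst s + 1..snd s}. rel_rank X i \<le> fst r
     then LEAST i. i \<in> {fst s + 1..snd s} \<and> rel_rank X i \<le> fst r
     else if \<exists>i\<in>{snd s + 1..n - 1}. rel_rank X i \<le> snd r
     then LEAST i. i \<in> {snd s + 1..n - 1} \<and> rel_rank X i \<le> snd r
     else n)"

definition dlp_win_prob :: "nat \<Rightarrow> nat \<Rightarrow> nat \<times> nat \<Rightarrow> nat \<times> nat \<Rightarrow> real" where
  "dlp_win_prob b n s r =
    measure_pmf.prob (pmf_of_set {X. X permutes {1..n}}) {X. X (dlp_pick n s r X) \<le> b}"

end

theory Submission
  imports Defs "HOL-Real_Asymp.Real_Asymp"
begin

text \<open>
  The winning probability is the sum over positions \<open>i\<close> of the probability that the policy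
  stops at \<open>i\<close> with an object of absolute rank at most \<open>b\<close>. Two classical facts make each
  summand explicit: the relative ranks \<open>Y\<^sub>1, Y\<^sub>2, \<dots>\<close> are independent with \<open>Y\<^sub>i\<close> uniform on
  \<open>{1..i}\<close>, and given \<open>Y\<^sub>1, \<dots>, Y\<^sub>i\<close> the absolute rank \<open>X\<^sub>i\<close> depends on \<open>Y\<^sub>i\<close> only, with
  \<open>P(X\<^sub>i = j | Y\<^sub>i = k) = C(j-1, k-1) C(n-j, i-k) / C(n, i)\<close>. Both come from one recursion
  (\<open>perm_prob_Suc\<close>): a uniform permutation of \<open>{1..n+1}\<close> arises from a uniform permutation of
  \<open>{1..n}\<close> by inserting a last element of uniform rank \<open>y\<close> and shifting the ranks \<open>\<ge> y\<close> up by
  one. Earlier relative ranks do not change, and an absolute rank moves by at most one, which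
  gives a Pascal-type recursion in \<open>n\<close> for the joint law (\<open>prob_stop_with_rank\<close>).

  Up to the last position, whose contribution is at most \<open>b/n\<close>, the winning probability is
  therefore a sum over \<open>s\<^sub>1 < i \<le> s\<^sub>2\<close> plus, weighted by the probability of surviving the first
  phase, a sum over \<open>s\<^sub>2 < i < n\<close> (\<open>dlp_win_prob_phases\<close>). If \<open>i/n \<longlongrightarrow> x\<close>, the product
  \<open>\<Prod>(1 - r/m)\<close> over \<open>s < m < i\<close> tends to \<open>(\<alpha>/x)\<^sup>r\<close> since it telescopes into a ratio of
  falling factorials, and the conditional law tends to \<open>C(j-1, k-1) x\<^sup>k (1-x)\<^bsup>j-k\<^esup>\<close>. The
  factor \<open>1/i\<close> turns each phase into a Riemann-type sum. Its convergence to the integral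
  follows from dominated convergence for the associated step functions
  (\<open>tendsto_step_sum_integral\<close>), so that pointwise limits along sequences \<open>i\<^sub>n \<sim> x n\<close> and a
  uniform bound suffice. In the limit the ranks \<open>j \<le> r\<close> contribute \<open>1\<close> each, by the binomial
  theorem; this is the summand \<open>r\<close> in the integrand.
\<close>

section \<open>Uniform permutations by inserting the last element\<close>

text \<open>Probabilities are kept as finite averages: \<open>perm_prob_Suc\<close> and \<open>perm_prob_partition\<close>
  are then reindexings of finite sums.\<close>

definition perm_prob :: "nat \<Rightarrow> ((nat \<Rightarrow> nat) \<Rightarrow> bool) \<Rightarrow> real" where
  "perm_prob n P = (\<Sum>X | X permutes {1..n}. of_bool (P X)) / fact n"

text \<open>The cycle \<open>y \<mapsto> y+1 \<mapsto> \<dots> \<mapsto> n+1 \<mapsto> y\<close>. Since a permutation \<open>p\<close> of \<open>{1..n}\<close> fixes \<open>n+1\<close>,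
  the permutation \<open>insert_rank n y \<circ> p\<close> extends the arrival order \<open>p\<close> by an object of rank \<open>y\<close>.\<close>
definition insert_rank :: "nat \<Rightarrow> nat \<Rightarrow> nat \<Rightarrow> nat" where
  "insert_rank n y m = (if m = Suc n then y else if y \<le> m \<and> m \<le> n then Suc m else m)"

lemma prob_eq_perm_prob:
  "measure_pmf.prob (pmf_of_set {X. X permutes {1..n}}) {X. P X} = perm_prob n P"
proof -
  have fin: "finite {X. X permutes {1..n}}" by (simp add: finite_permutations)
  have ne: "{X. X permutes {1..n}} \<noteq> {}" using permutes_id by blast
  have "measure_pmf.prob (pmf_of_set {X. X permutes {1..n}}) {X. P X}
      = real (card ({X. X permutes {1..n}} \<inter> {X. P X})) / real (card {X. X permutes {1..n}})"
    by (rule measure_pmf_of_set[OF ne fin])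
  also have "card {X. X permutes {1..n}} = fact n"
    by (simp add: card_permutations)
  also have "real (card ({X. X permutes {1..n}} \<inter> {X. P X})) = (\<Sum>X | X permutes {1..n}. of_bool (P X))"
    using fin by simp
  finally show ?thesis unfolding perm_prob_def by simp
qed

lemma perm_prob_cong:
  assumes "\<And>X. X permutes {1..n} \<Longrightarrow> P X \<longleftrightarrow> Q X"
  shows "perm_prob n P = perm_prob n Q"
  unfolding perm_prob_def using assms by (intro arg_cong2[where f = "(/)"] sum.cong) auto

lemma perm_prob_nonneg: "0 \<le> perm_prob n P"
  unfolding perm_prob_def by (intro divide_nonneg_pos sum_nonneg) auto

lemma perm_prob_mono:
  assumes "\<And>X. X permutes {1..n} \<Longrightarrow> P X \<Longrightarrow> Q X"
  shows "perm_prob n P \<le> perm_prob n Q"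
  unfolding perm_prob_def using assms by (intro divide_right_mono sum_mono) auto

lemma perm_prob_True: "perm_prob n (\<lambda>_. True) = 1"
  unfolding perm_prob_def by (simp add: card_permutations)

lemma perm_prob_False: "perm_prob n (\<lambda>_. False) = 0"
  unfolding perm_prob_def by simp

text \<open>The law of total probability, for a random quantity \<open>f\<close> that takes values in the finite
  set \<open>I\<close> on the event \<open>P\<close>.\<close>
lemma perm_prob_partition:
  assumes "finite I" and "\<And>X. X permutes {1..n} \<Longrightarrow> P X \<Longrightarrow> f X \<in> I"
  shows "perm_prob n P = (\<Sum>i\<in>I. perm_prob n (\<lambda>X. P X \<and> f X = i))"
proof -
  have "(\<Sum>i\<in>I. of_bool (P X \<and> f X = i)) = (of_bool (P X) :: real)" if "X permutes {1..n}" for X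
    using assms that by (cases "P X") (auto simp: of_bool_def if_distrib sum.delta' cong: if_cong)
  then show ?thesis
    unfolding perm_prob_def sum_divide_distrib[symmetric]
    by (subst sum.swap) (intro arg_cong2[where f = "(/)"] sum.cong, auto)
qed

lemma insert_rank_permutes:
  assumes "y \<in> {1..Suc n}"
  shows "insert_rank n y permutes {1..Suc n}"
proof (rule bij_imp_permutes)
  have inj: "inj_on (insert_rank n y) {1..Suc n}"
    using assms by (auto simp: inj_on_def insert_rank_def split: if_splits)
  have "insert_rank n y ` {1..Suc n} \<subseteq> {1..Suc n}"
    using assms by (auto simp: insert_rank_def split: if_splits)
  then show "bij_betw (insert_rank n y) {1..Suc n} {1..Suc n}"
    using inj endo_inj_surj[of "{1..Suc n}"] by (auto simp: bij_betw_def)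
  show "insert_rank n y x = x" if "x \<notin> {1..Suc n}" for x
    using assms that by (auto simp: insert_rank_def)
qed

text \<open>The inserted rank is read off at position \<open>n+1\<close>, which gives injectivity; both sides have
  \<open>(n+1)!\<close> elements.\<close>
lemma insert_rank_bij:
  "bij_betw (\<lambda>(y, p). insert_rank n y \<circ> p)
    ({1..Suc n} \<times> {p. p permutes {1..n}}) {X. X permutes {1..Suc n}}"
proof -
  let ?f = "\<lambda>(y, p). insert_rank n y \<circ> p"
  let ?A = "{1..Suc n} \<times> {p. p permutes {1..n}}"
  have last: "p (Suc n) = Suc n" if "p permutes {1..n}" for p
    using that by (auto simp: permutes_def)
  have inj: "inj_on ?f ?A"
  proof (rule inj_onI, clarify)
    fix y p y' p'
    assume p: "p permutes {1..n}" "p' permutes {1..n}" and y: "y \<in> {1..Suc n}" "y' \<in> {1..Suc n}"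
      and eq: "insert_rank n y \<circ> p = insert_rank n y' \<circ> p'"
    have "y = y'"
      using fun_cong[OF eq, of "Suc n"] p by (simp add: last insert_rank_def)
    moreover have "inj (insert_rank n y)"
      using insert_rank_permutes[OF y(1)] permutes_inj by blast
    ultimately show "y = y' \<and> p = p'"
      using eq by (auto simp: fun_eq_iff inj_def)
  qed
  have sub: "?f ` ?A \<subseteq> {X. X permutes {1..Suc n}}"
  proof clarify
    fix y p assume "y \<in> {1..Suc n}" and "p permutes {1..n}"
    then show "(insert_rank n y \<circ> p) permutes {1..Suc n}"
      by (intro permutes_compose insert_rank_permutes) (auto elim: permutes_subset)
  qed
  have "card (?f ` ?A) = card {X. X permutes {1..Suc n}}"
    using card_image[OF inj] card_permutations[of "{1..Suc n}" "Suc n"] card_permutations[of "{1..n}" n]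
    by (simp add: card_cartesian_product)
  then have "?f ` ?A = {X. X permutes {1..Suc n}}"
    using sub by (intro card_subset_eq) (simp_all add: finite_permutations)
  then show ?thesis using inj by (simp add: bij_betw_def)
qed

lemma perm_prob_Suc:
  "perm_prob (Suc n) P = (\<Sum>y=1..Suc n. perm_prob n (\<lambda>p. P (insert_rank n y \<circ> p))) / Suc n"
proof -
  have "(\<Sum>X | X permutes {1..Suc n}. of_bool (P X)) =
      (\<Sum>(y, p)\<in>{1..Suc n} \<times> {p. p permutes {1..n}}. of_bool (P (insert_rank n y \<circ> p)) :: real)"
    by (subst sum.reindex_bij_betw[OF insert_rank_bij, symmetric]) (simp add: case_prod_unfold)
  also have "\<dots> = (\<Sum>y=1..Suc n. \<Sum>p | p permutes {1..n}. of_bool (P (insert_rank n y \<circ> p)))"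
    by (rule sum.cartesian_product[symmetric])
  finally show ?thesis
    unfolding perm_prob_def by (simp add: sum_divide_distrib[symmetric] field_simps del: sum.cl_ivl_Suc)
qed

text \<open>The cycle is strictly increasing on \<open>{1..n}\<close>, so comparisons among the first \<open>n\<close> objects
  are unaffected.\<close>
lemma rel_rank_insert_rank:
  assumes "p permutes {1..n}" and "m \<le> n"
  shows "rel_rank (insert_rank n y \<circ> p) m = rel_rank p m"
proof (cases "m = 0")
  case False
  have "p k \<in> {1..n}" if "k \<in> {1..m}" for k
    using permutes_in_image[OF assms(1), of k] that assms(2) by auto
  then have bound: "p k \<le> n" if "k \<in> {1..m}" for k
    using that by fastforce
  have "insert_rank n y (p k) \<le> insert_rank n y (p m) \<longleftrightarrow> p k \<le> p m" if "k \<in> {1..m}" for k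
    using bound[OF that] bound[of m] False by (auto simp: insert_rank_def)
  then show ?thesis unfolding rel_rank_def by (auto intro!: arg_cong[where f = card])
qed (simp add: rel_rank_def)

lemma rel_rank_last:
  assumes X: "X permutes {1..n}" and "n \<ge> 1"
  shows "rel_rank X n = X n"
proof -
  have "X n \<in> {1..n}" using permutes_in_image[OF X, of n] assms by simp
  have "X ` {k \<in> {1..n}. X k \<le> X n} = {1..X n}"
  proof -
    have "X ` {k \<in> {1..n}. X k \<le> X n} = {j \<in> X ` {1..n}. j \<le> X n}" by auto
    then show ?thesis using permutes_image[OF X] \<open>X n \<in> {1..n}\<close> by auto
  qed
  moreover have "inj_on X {k \<in> {1..n}. X k \<le> X n}"
    using permutes_inj[OF X] inj_on_subset by blast
  ultimately show ?thesis unfolding rel_rank_def using card_image by fastforce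
qed

lemma rel_rank_bounds: "1 \<le> m \<Longrightarrow> rel_rank X m \<in> {1..m}"
proof -
  assume "1 \<le> m"
  then have "{m} \<subseteq> {k \<in> {1..m}. X k \<le> X m}" by auto
  then have "card {m} \<le> rel_rank X m"
    unfolding rel_rank_def by (intro card_mono) auto
  moreover have "rel_rank X m \<le> card {1..m}"
    unfolding rel_rank_def by (intro card_mono) auto
  ultimately show ?thesis by simp
qed

section \<open>Joint law of the stopping event and the ranks\<close>

text \<open>A general threshold policy stops at \<open>m\<close> if the relative rank there is at most \<open>t m\<close>.
  The value \<open>t m = 0\<close> forbids stopping at \<open>m\<close>, because relative ranks are positive.\<close>
definition unstopped :: "(nat \<Rightarrow> nat) \<Rightarrow> nat \<Rightarrow> (nat \<Rightarrow> nat) \<Rightarrow> bool" where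
  "unstopped t i X \<longleftrightarrow> (\<forall>m\<in>{1..i}. t m < rel_rank X m)"

lemma unstopped_insert_rank:
  assumes "p permutes {1..n}" and "i \<le> n"
  shows "unstopped t i (insert_rank n y \<circ> p) \<longleftrightarrow> unstopped t i p"
  unfolding unstopped_def using assms rel_rank_insert_rank by auto

lemma insert_rank_last:
  assumes "p permutes {1..n}" and y: "y \<in> {1..Suc n}"
  shows "(insert_rank n y \<circ> p) (Suc n) = y" "rel_rank (insert_rank n y \<circ> p) (Suc n) = y"
proof -
  show *: "(insert_rank n y \<circ> p) (Suc n) = y"
    using assms by (auto simp: permutes_def insert_rank_def)
  have "(insert_rank n y \<circ> p) permutes {1..Suc n}"
    using assms by (intro permutes_compose insert_rank_permutes) (auto elim: permutes_subset)
  then show "rel_rank (insert_rank n y \<circ> p) (Suc n) = y"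
    using rel_rank_last * by simp
qed

text \<open>The relative rank at position \<open>n+1\<close> is the inserted rank, hence uniform on \<open>{1..n+1}\<close>
  and independent of the earlier ones.\<close>
lemma prob_unstopped:
  "perm_prob n (unstopped t n) = (\<Prod>m=1..n. real (m - t m) / real m)"
proof (induction n)
  case 0
  then show ?case by (simp add: unstopped_def perm_prob_True)
next
  case (Suc n)
  have "perm_prob n (\<lambda>p. unstopped t (Suc n) (insert_rank n y \<circ> p)) =
      of_bool (t (Suc n) < y) * perm_prob n (unstopped t n)" if "y \<in> {1..Suc n}" for y
  proof -
    have "perm_prob n (\<lambda>p. unstopped t (Suc n) (insert_rank n y \<circ> p)) =
        perm_prob n (\<lambda>p. t (Suc n) < y \<and> unstopped t n p)"
      by (intro perm_prob_cong)
        (use that insert_rank_last rel_rank_insert_rank in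
          \<open>auto simp: unstopped_def atLeastAtMostSuc_conv simp del: comp_apply\<close>)
    then show ?thesis by (cases "t (Suc n) < y") (simp_all add: perm_prob_False)
  qed
  then have "perm_prob (Suc n) (unstopped t (Suc n)) =
      (\<Sum>y=1..Suc n. of_bool (t (Suc n) < y) * perm_prob n (unstopped t n)) / Suc n"
    unfolding perm_prob_Suc by (intro arg_cong2[where f = "(/)"] sum.cong) auto
  also have "(\<Sum>y=1..Suc n. of_bool (t (Suc n) < y) * perm_prob n (unstopped t n)) =
      real (card ({1..Suc n} \<inter> {y. t (Suc n) < y})) * perm_prob n (unstopped t n)"
    by (simp add: sum_distrib_right[symmetric] del: sum.cl_ivl_Suc)
  also have "{1..Suc n} \<inter> {y. t (Suc n) < y} = {Suc (t (Suc n))..Suc n}" by auto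
  finally show ?case using Suc by (simp add: mult.commute)
qed

lemma real_binomial_absorb_comp:
  "(real m - real l) * real (m choose l) = real m * real ((m - 1) choose l)"
proof (cases "l \<le> m")
  case True
  then have "(real m - real l) = real (m - l)" by simp
  then show ?thesis using binomial_absorb_comp[of m l] by (metis of_nat_mult)
qed (auto simp: binomial_eq_0)

text \<open>The object of position \<open>i\<close> has rank \<open>j\<close> after the insertion of rank \<open>y\<close> iff either it had
  rank \<open>j\<close> and \<open>y > j\<close> (\<open>n+1-j\<close> choices), or it had rank \<open>j-1\<close> and \<open>y \<le> j-1\<close>
  (\<open>j-1\<close> choices).\<close>
lemma prob_absolute_rank_step:
  assumes "1 \<le> i" "i \<le> n" "1 \<le> j" "j \<le> Suc n"
  shows "perm_prob (Suc n) (\<lambda>X. (unstopped t (i - 1) X \<and> rel_rank X i = k) \<and> X i = j) =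
    (real (Suc n - j) * perm_prob n (\<lambda>X. (unstopped t (i - 1) X \<and> rel_rank X i = k) \<and> X i = j)
     + real (j - 1) * perm_prob n (\<lambda>X. (unstopped t (i - 1) X \<and> rel_rank X i = k) \<and> X i = j - 1)) / Suc n"
proof -
  let ?R = "\<lambda>X. unstopped t (i - 1) X \<and> rel_rank X i = k"
  let ?a = "perm_prob n (\<lambda>X. ?R X \<and> X i = j)" and ?b = "perm_prob n (\<lambda>X. ?R X \<and> X i = j - 1)"
  have "perm_prob n (\<lambda>p. ?R (insert_rank n y \<circ> p) \<and> (insert_rank n y \<circ> p) i = j) =
      (if y \<le> j - 1 then ?b else 0) + (if j < y then ?a else 0)" if y: "y \<in> {1..Suc n}" for y
  proof -
    have "perm_prob n (\<lambda>p. ?R (insert_rank n y \<circ> p) \<and> (insert_rank n y \<circ> p) i = j) =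
        perm_prob n (\<lambda>p. ?R p \<and> (y \<le> j - 1 \<and> p i = j - 1 \<or> j < y \<and> p i = j))"
    proof (intro perm_prob_cong)
      fix p assume p: "p permutes {1..n}"
      have "p i \<in> {1..n}" using permutes_in_image[OF p, of i] assms by auto
      then have "(insert_rank n y \<circ> p) i = j \<longleftrightarrow> (y \<le> j - 1 \<and> p i = j - 1 \<or> j < y \<and> p i = j)"
        using assms y by (auto simp: insert_rank_def)
      moreover have "?R (insert_rank n y \<circ> p) \<longleftrightarrow> ?R p"
        using unstopped_insert_rank[OF p] rel_rank_insert_rank[OF p] assms by simp
      ultimately show "(?R (insert_rank n y \<circ> p) \<and> (insert_rank n y \<circ> p) i = j) \<longleftrightarrow>
         (?R p \<and> (y \<le> j - 1 \<and> p i = j - 1 \<or> j < y \<and> p i = j))" by simp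
    qed
    then show ?thesis
      by (cases "y \<le> j - 1"; cases "j < y") (simp_all add: perm_prob_False)
  qed
  then have "perm_prob (Suc n) (\<lambda>X. ?R X \<and> X i = j) =
      (\<Sum>y=1..Suc n. (if y \<le> j - 1 then ?b else 0) + (if j < y then ?a else 0)) / Suc n"
    unfolding perm_prob_Suc by (intro arg_cong2[where f = "(/)"] sum.cong) auto
  also have "(\<Sum>y=1..Suc n. (if y \<le> j - 1 then ?b else 0) + (if j < y then ?a else 0)) =
      real (card ({1..Suc n} \<inter> {y. y \<le> j - 1})) * ?b + real (card ({1..Suc n} \<inter> {y. j < y})) * ?a"
    by (simp add: sum.distrib sum.If_cases del: sum.cl_ivl_Suc)
  also have "{1..Suc n} \<inter> {y. y \<le> j - 1} = {1..j - 1}" using assms by auto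
  also have "{1..Suc n} \<inter> {y. j < y} = {Suc j..Suc n}" by auto
  finally show ?thesis by (simp add: add.commute)
qed

text \<open>The probability that the \<open>i\<close>-th of \<open>n\<close> objects has absolute rank \<open>j\<close>, given that its
  relative rank is \<open>k\<close>: the rank set of the first \<open>i\<close> objects is a uniform \<open>i\<close>-subset of
  \<open>{1..n}\<close>, whose \<open>k\<close>-th smallest element has to be \<open>j\<close>.\<close>
definition rank_kernel :: "nat \<Rightarrow> nat \<Rightarrow> nat \<Rightarrow> nat \<Rightarrow> real" where
  "rank_kernel n i k j =
    real ((j - 1) choose (k - 1)) * (real ((n - j) choose (i - k)) / real (n choose i))"

text \<open>The same recursion as in \<open>prob_absolute_rank_step\<close>. After multiplication by \<open>C(n, i)\<close>
  the absorption identity \<open>(m - l) C(m, l) = m C(m-1, l)\<close>, applied to each binomial coefficient,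
  makes both terms multiples of \<open>C(j-1, k-1) C(n+1-j, i-k)\<close>.\<close>
lemma rank_kernel_step:
  assumes "1 \<le> k" "k \<le> i" "i \<le> n" "1 \<le> j" "j \<le> Suc n"
  shows "rank_kernel (Suc n) i k j =
    (real (Suc n - j) * rank_kernel n i k j + real (j - 1) * rank_kernel n i k (j - 1)) / Suc n"
proof -
  let ?A = "real ((j - 1) choose (k - 1))" and ?B = "real ((Suc n - j) choose (i - k))"
  have c: "(real (Suc n) - real i) * real (Suc n choose i) = real (Suc n) * real (n choose i)"
    using real_binomial_absorb_comp[of "Suc n" i] by simp
  have a: "(real j - real k) * ?A = real (j - 1) * real ((j - 2) choose (k - 1))"
    using real_binomial_absorb_comp[of "j - 1" "k - 1"] assms by (simp add: numeral_2_eq_2)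
  have b: "(real (Suc n - j) - (real i - real k)) * ?B =
      real (Suc n - j) * real ((n - j) choose (i - k))"
    using real_binomial_absorb_comp[of "Suc n - j" "i - k"] assms by (simp add: of_nat_diff)
  have pos: "real (n choose i) > 0" "real (Suc n choose i) > 0"
    using assms by (auto simp: zero_less_binomial_iff simp del: binomial_Suc_Suc)
  have last: "real (j - 1) * real (n - (j - 1) choose (i - k)) = real (j - 1) * ?B"
    using assms by (cases "j = 1") (auto simp: Suc_diff_le)
  have "(real (Suc n - j) * rank_kernel n i k j + real (j - 1) * rank_kernel n i k (j - 1))
     * real (n choose i) =
     ?A * (real (Suc n - j) * real ((n - j) choose (i - k)))
     + (real (j - 1) * real (n - (j - 1) choose (i - k))) * real ((j - 2) choose (k - 1))"
    unfolding rank_kernel_def using pos by (simp add: field_simps numeral_2_eq_2)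
  also have "\<dots> = ?A * ((real (Suc n - j) - (real i - real k)) * ?B) +
      ((real j - real k) * ?A) * ?B"
    unfolding last a b by (simp add: mult_ac)
  also have "\<dots> = (real (Suc n) - real i) * ?A * ?B"
    using assms by (simp add: of_nat_diff algebra_simps)
  finally have s: "real (Suc n - j) * rank_kernel n i k j + real (j - 1) * rank_kernel n i k (j - 1) =
     (real (Suc n) - real i) * ?A * ?B / real (n choose i)"
    using pos by (simp add: field_simps)
  have "(real (Suc n) - real i) / real (n choose i) = real (Suc n) / real (Suc n choose i)"
    by (rule frac_eq_eq[THEN iffD2, OF _ _ c]) (use pos in linarith)+
  moreover have "(real (Suc n) - real i) * ?A * ?B / real (n choose i)
      = ?A * ?B * ((real (Suc n) - real i) / real (n choose i))"
    by (simp del: of_nat_Suc)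
  ultimately have "(real (Suc n) - real i) * ?A * ?B / real (n choose i) / real (Suc n)
      = ?A * (?B / real (Suc n choose i))"
    by (simp del: binomial_Suc_Suc of_nat_Suc)
  then show ?thesis
    unfolding s by (simp only: rank_kernel_def)
qed

text \<open>Induction on \<open>n\<close> from \<open>n = i\<close>, where absolute and relative rank of the \<open>i\<close>-th object
  coincide; the step is the common recursion of both sides.\<close>
lemma prob_stop_with_rank:
  assumes "1 \<le> k" "k \<le> i" "i \<le> n" "1 \<le> j" "j \<le> n"
  shows "perm_prob n (\<lambda>X. (unstopped t (i - 1) X \<and> rel_rank X i = k) \<and> X i = j) =
    (\<Prod>m=1..i-1. real (m - t m) / real m) / real i * rank_kernel n i k j"
  using \<open>i \<le> n\<close> \<open>1 \<le> j\<close> \<open>j \<le> n\<close>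
proof (induction n arbitrary: j rule: dec_induct)
  case base
  obtain l where l: "i = Suc l" using assms by (cases i) auto
  have "perm_prob l (\<lambda>p. (unstopped t (i - 1) (insert_rank l y \<circ> p) \<and>
        rel_rank (insert_rank l y \<circ> p) i = k) \<and> (insert_rank l y \<circ> p) i = j) =
      (if y = k then if j = k then perm_prob l (unstopped t l) else 0 else 0)"
    if y: "y \<in> {1..i}" for y
  proof -
    have "perm_prob l (\<lambda>p. (unstopped t (i - 1) (insert_rank l y \<circ> p) \<and>
        rel_rank (insert_rank l y \<circ> p) i = k) \<and> (insert_rank l y \<circ> p) i = j) =
       perm_prob l (\<lambda>p. unstopped t l p \<and> y = k \<and> y = j)"
      by (intro perm_prob_cong)
        (use y insert_rank_last unstopped_insert_rank in \<open>auto simp: l simp del: comp_apply\<close>)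
    then show ?thesis by (auto simp: perm_prob_False)
  qed
  then have "perm_prob i (\<lambda>X. (unstopped t (i - 1) X \<and> rel_rank X i = k) \<and> X i = j) =
      (\<Sum>y=1..i. if y = k then if j = k then perm_prob l (unstopped t l) else 0 else 0) / real i"
    unfolding l perm_prob_Suc by (intro arg_cong2[where f = "(/)"] sum.cong) auto
  also have "\<dots> = (if j = k then perm_prob l (unstopped t l) else 0) / real i"
    using assms by (simp add: sum.delta)
  also have "\<dots> = perm_prob l (unstopped t l) / real i * rank_kernel i i k j"
  proof -
    have "rank_kernel i i k j = of_bool (j = k)"
      using base \<open>1 \<le> k\<close> \<open>k \<le> i\<close> unfolding rank_kernel_def
      by (cases j k rule: linorder_cases) (auto simp: binomial_eq_0)
    then show ?thesis by simp
  qed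
  finally show ?case by (simp add: prob_unstopped l)
next
  case (step n)
  let ?P = "\<lambda>n j. perm_prob n (\<lambda>X. (unstopped t (i - 1) X \<and> rel_rank X i = k) \<and> X i = j)"
  let ?c = "(\<Prod>m=1..i-1. real (m - t m) / real m) / real i"
  \<comment> \<open>At the borders \<open>j = n + 1\<close> and \<open>j = 1\<close> the induction hypothesis does not apply, but the
    coefficient vanishes.\<close>
  have 1: "real (Suc n - j) * ?P n j = real (Suc n - j) * (?c * rank_kernel n i k j)"
    using step.IH[of j] step.prems by (cases "j = Suc n") auto
  have 2: "real (j - 1) * ?P n (j - 1) = real (j - 1) * (?c * rank_kernel n i k (j - 1))"
    using step.IH[of "j - 1"] step.prems by (cases "j = 1") auto
  have "?P (Suc n) j = (real (Suc n - j) * ?P n j + real (j - 1) * ?P n (j - 1)) / Suc n"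
    using prob_absolute_rank_step[of i n j t k] assms step by simp
  also have "\<dots> = ?c * ((real (Suc n - j) * rank_kernel n i k j + real (j - 1) * rank_kernel n i k (j - 1)) / Suc n)"
    unfolding 1 2 by (simp add: algebra_simps del: of_nat_Suc)
  also have "\<dots> = ?c * rank_kernel (Suc n) i k j"
    using rank_kernel_step[of k i n j] assms step by simp
  finally show ?case .
qed

section \<open>Limits of the survival product and of the rank kernel\<close>

lemma binomial_shrink: "k \<le> j \<Longrightarrow> j \<le> n \<Longrightarrow> k \<le> i \<Longrightarrow> (n - j) choose (i - k) \<le> n choose i"
proof (induction j arbitrary: k)
  case (Suc j)
  have n: "n - j = Suc (n - Suc j)" using Suc.prems by simp
  show ?case
  proof (cases k)
    case 0
    have "(n - Suc j) choose i \<le> (n - j) choose i"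
      unfolding n by (cases i) simp_all
    also have "\<dots> \<le> n choose i" using Suc.IH[of 0] Suc.prems by simp
    finally show ?thesis by (simp add: 0)
  next
    case (Suc l)
    have i: "i - l = Suc (i - Suc l)" using Suc Suc.prems by simp
    have "(n - Suc j) choose (i - Suc l) \<le> (n - j) choose (i - l)"
      unfolding n i binomial_Suc_Suc by simp
    also have "\<dots> \<le> n choose i" using Suc.IH[of l] Suc Suc.prems by simp
    finally show ?thesis by (simp add: Suc)
  qed
qed simp

text \<open>Each factor \<open>(m-r)/m\<close> is itself the product of \<open>(m-1-q)/(m-q)\<close> over \<open>q < r\<close>, and for
  fixed \<open>q\<close> these telescope over \<open>m\<close>. The point is that the right-hand side has a fixed number
  of factors.\<close>
lemma prod_falling_ratio:
  assumes "r \<le> s" "s \<le> u"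
  shows "(\<Prod>m=s+1..u. real (m - r) / real m) = (\<Prod>q<r. (real s - real q) / (real u - real q))"
  using assms(2)
proof (induction u rule: dec_induct)
  case base
  show ?case using assms by (simp add: prod.neutral)
next
  case (step u)
  have nz: "real u - real q \<noteq> 0" "real (Suc u) - real q \<noteq> 0" if "q < r" for q
    using that assms step by auto
  have "(\<Prod>q<r. (real u - real q) / (real (Suc u) - real q)) = real (Suc u - r) / real (Suc u)"
    using assms(1) step(1)
  proof (induction r)
    case (Suc r)
    then show ?case by (simp add: of_nat_diff divide_simps)
  qed simp
  then have "(\<Prod>m=s+1..Suc u. real (m - r) / real m) =
    (\<Prod>q<r. (real s - real q) / (real u - real q)) * (\<Prod>q<r. (real u - real q) / (real (Suc u) - real q))"
    using step by simp
  also have "\<dots> = (\<Prod>q<r. (real s - real q) / (real (Suc u) - real q))"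
    unfolding prod.distrib[symmetric] using nz by (intro prod.cong) (auto simp: divide_simps)
  finally show ?case .
qed

lemma tendsto_shifted_ratio:
  fixes s u :: "nat \<Rightarrow> nat"
  assumes s: "(\<lambda>n. real (s n) / real n) \<longlonglongrightarrow> a" and u: "(\<lambda>n. real (u n) / real n) \<longlonglongrightarrow> x" and "x \<noteq> 0"
  shows "(\<lambda>n. (real (s n) - c) / (real (u n) - d)) \<longlonglongrightarrow> a / x"
proof -
  have inv: "(\<lambda>n. e / real n) \<longlonglongrightarrow> 0" for e :: real by real_asymp
  have "(\<lambda>n. (real (s n) / real n - c / real n) / (real (u n) / real n - d / real n)) \<longlonglongrightarrow> a / x"
    using tendsto_divide[OF tendsto_diff[OF s inv[of c]] tendsto_diff[OF u inv[of d]]] \<open>x \<noteq> 0\<close> by simp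
  moreover have "\<forall>\<^sub>F n in sequentially. (real (s n) / real n - c / real n) / (real (u n) / real n - d / real n)
      = (real (s n) - c) / (real (u n) - d)"
    using eventually_gt_at_top[of 0]
    by eventually_elim (simp add: diff_divide_distrib[symmetric])
  ultimately show ?thesis by (rule Lim_transform_eventually)
qed

lemma eventually_gt_const:
  fixes u :: "nat \<Rightarrow> nat"
  assumes "(\<lambda>n. real (u n) / real n) \<longlonglongrightarrow> x" and "0 < x"
  shows "\<forall>\<^sub>F n in sequentially. C < u n"
proof -
  have "filterlim (\<lambda>n. real (u n) / real n * real n) at_top sequentially"
    using filterlim_tendsto_pos_mult_at_top[OF assms filterlim_real_sequentially] .
  then have "\<forall>\<^sub>F n in sequentially. real C < real (u n) / real n * real n"
    by (simp add: filterlim_at_top_dense)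
  then show ?thesis
    using eventually_gt_at_top[of 0] by eventually_elim simp
qed

lemma eventually_less_of_ratio:
  fixes s u :: "nat \<Rightarrow> nat"
  assumes "(\<lambda>n. real (s n) / real n) \<longlonglongrightarrow> a" and "(\<lambda>n. real (u n) / real n) \<longlonglongrightarrow> x" and "a < x"
  shows "\<forall>\<^sub>F n in sequentially. s n < u n"
proof -
  obtain y where y: "a < y" "y < x" using dense[OF assms(3)] by blast
  show ?thesis
    using order_tendstoD(2)[OF assms(1) y(1)] order_tendstoD(1)[OF assms(2) y(2)]
      eventually_gt_at_top[of 0]
  proof eventually_elim
    case (elim n)
    then have "real (s n) / real n < real (u n) / real n" by linarith
    then show ?case using elim by (simp add: divide_less_cancel)
  qed
qed

lemma tendsto_survival_prod:
  fixes s u :: "nat \<Rightarrow> nat"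
  assumes s: "(\<lambda>n. real (s n) / real n) \<longlonglongrightarrow> a" and u: "(\<lambda>n. real (u n) / real n) \<longlonglongrightarrow> x"
    and "0 < a" "a < x"
  shows "(\<lambda>n. \<Prod>m=s n + 1..u n. real (m - r) / real m) \<longlonglongrightarrow> (a / x) ^ r"
proof -
  have "(\<lambda>n. \<Prod>q<r. (real (s n) - real q) / (real (u n) - real q)) \<longlonglongrightarrow> (a / x) ^ r"
    using tendsto_prod[of "{..<r}" "\<lambda>q n. (real (s n) - real q) / (real (u n) - real q)" "\<lambda>_. a / x" sequentially]
      tendsto_shifted_ratio[OF s u] assms by simp
  moreover have "\<forall>\<^sub>F n in sequentially. (\<Prod>q<r. (real (s n) - real q) / (real (u n) - real q))
      = (\<Prod>m=s n + 1..u n. real (m - r) / real m)"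
    using eventually_gt_const[OF s \<open>0 < a\<close>, of r] eventually_less_of_ratio[OF s u \<open>a < x\<close>]
    by eventually_elim (subst prod_falling_ratio, auto)
  ultimately show ?thesis by (rule Lim_transform_eventually)
qed

lemma mult_ratio_eq:
  fixes c d e p q :: real
  assumes "e \<noteq> 0" and "d * p = e * q"
  shows "p / c * (d / e) = q / c"
proof -
  have "p / c * (d / e) = (d * p) / (e * c)" by (simp add: mult.commute)
  then show ?thesis using assms by simp
qed

text \<open>Peeling off one element multiplies the ratio by \<open>(u n - l)/(n - j)\<close> or by
  \<open>1 - u n/(n - j)\<close>, according to whether it is chosen; these factors tend to \<open>x\<close> and \<open>1 - x\<close>.\<close>
lemma tendsto_choose_ratio:
  fixes u :: "nat \<Rightarrow> nat"
  assumes u: "(\<lambda>n. real (u n) / real n) \<longlonglongrightarrow> x" and x: "0 < x" "x < 1"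
  shows "k \<le> j \<Longrightarrow> (\<lambda>n. real ((n - j) choose (u n - k)) / real (n choose u n)) \<longlonglongrightarrow> x ^ k * (1 - x) ^ (j - k)"
proof (induction j arbitrary: k)
  case 0
  have one: "(\<lambda>n. real n / real n) \<longlonglongrightarrow> 1" by real_asymp
  have "\<forall>\<^sub>F n in sequentially. real ((n - 0) choose (u n - k)) / real (n choose u n) = 1"
    using eventually_less_of_ratio[OF u one x(2)]
    by eventually_elim (use 0 in auto)
  then show ?case using 0 by (simp add: tendsto_eventually)
next
  case (Suc j)
  let ?q = "\<lambda>j k n. real ((n - j) choose (u n - k)) / real (n choose u n)"
  have one: "(\<lambda>n. real n / real n) \<longlonglongrightarrow> 1" by real_asymp
  have ev: "\<forall>\<^sub>F n in sequentially. j < n - u n \<and> u n < n \<and> Suc k < u n"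
  proof -
    have "(\<lambda>n. real (n - u n) / real n) \<longlonglongrightarrow> 1 - x"
    proof -
      have "(\<lambda>n. real n / real n - real (u n) / real n) \<longlonglongrightarrow> 1 - x"
        by (intro tendsto_diff one u)
      moreover have "\<forall>\<^sub>F n in sequentially. real n / real n - real (u n) / real n = real (n - u n) / real n"
        using eventually_less_of_ratio[OF u one x(2)]
        by eventually_elim (simp add: of_nat_diff diff_divide_distrib)
      ultimately show ?thesis by (rule Lim_transform_eventually)
    qed
    then have "\<forall>\<^sub>F n in sequentially. j < n - u n"
      by (rule eventually_gt_const) (use x in simp)
    then show ?thesis
      using eventually_less_of_ratio[OF u one x(2)] eventually_gt_const[OF u x(1), of "Suc k"]
      by eventually_elim simp
  qed
  show ?case
  proof (cases k)
    case 0
    have "(\<lambda>n. 1 - real (u n) / (real n - real j)) \<longlonglongrightarrow> 1 - x / 1"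
      using tendsto_diff[OF tendsto_const[of 1] tendsto_shifted_ratio[OF u one, of 0 "real j"]] by simp
    then have "(\<lambda>n. ?q j 0 n * (1 - real (u n) / (real n - real j)))
        \<longlonglongrightarrow> x ^ 0 * (1 - x) ^ (j - 0) * (1 - x / 1)"
      by (intro tendsto_mult Suc.IH) auto
    moreover have "\<forall>\<^sub>F n in sequentially. ?q j 0 n * (1 - real (u n) / (real n - real j)) = ?q (Suc j) 0 n"
      using ev
    proof eventually_elim
      case (elim n)
      have "(n - j - u n) * ((n - j) choose u n) = (n - j) * ((n - j - 1) choose u n)"
        by (rule binomial_absorb_comp)
      then have "real (n - j - u n) * real ((n - j) choose u n) = real (n - j) * real ((n - j - 1) choose u n)"
        by (metis of_nat_mult)
      moreover have "real (n - j - u n) = real n - real j - real (u n)" "real (n - j) = real n - real j"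
        "n - j - 1 = n - Suc j" "real n - real j > 0"
        using elim by (auto simp: of_nat_diff)
      ultimately have "(real n - real j - real (u n)) * real ((n - j) choose u n)
          = (real n - real j) * real ((n - Suc j) choose u n)" and nz: "real n - real j \<noteq> 0"
        by (metis, simp)
      moreover have "1 - real (u n) / (real n - real j) = (real n - real j - real (u n)) / (real n - real j)"
        using nz by (simp add: diff_divide_distrib)
      ultimately show ?case using mult_ratio_eq by simp
    qed
    ultimately have "?q (Suc j) 0 \<longlonglongrightarrow> x ^ 0 * (1 - x) ^ (j - 0) * (1 - x / 1)"
      by (rule Lim_transform_eventually)
    then show ?thesis by (simp add: 0 mult_ac)
  next
    case k: (Suc l)
    have "(\<lambda>n. ?q j l n * ((real (u n) - real l) / (real n - real j)))
        \<longlonglongrightarrow> x ^ l * (1 - x) ^ (j - l) * (x / 1)"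
      using Suc.prems k by (intro tendsto_mult Suc.IH tendsto_shifted_ratio[OF u one]) auto
    moreover have "\<forall>\<^sub>F n in sequentially. ?q j l n * ((real (u n) - real l) / (real n - real j)) = ?q (Suc j) k n"
      using ev
    proof eventually_elim
      case (elim n)
      have "Suc (u n - k) * (Suc (n - Suc j) choose Suc (u n - k)) = Suc (n - Suc j) * (n - Suc j choose (u n - k))"
        by (rule Suc_times_binomial)
      moreover have "Suc (u n - k) = u n - l" "Suc (n - Suc j) = n - j"
        using elim k by auto
      ultimately have "real (u n - l) * real ((n - j) choose (u n - l)) = real (n - j) * real (n - Suc j choose (u n - k))"
        by (metis of_nat_mult)
      moreover have "real (u n - l) = real (u n) - real l" "real (n - j) = real n - real j"
        "real n - real j > 0"
        using elim k by (auto simp: of_nat_diff)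
      ultimately have "(real (u n) - real l) * real ((n - j) choose (u n - l))
          = (real n - real j) * real ((n - Suc j) choose (u n - k))" and nz: "real n - real j \<noteq> 0"
        by simp_all
      from mult_ratio_eq[OF nz this(1)] show ?case .
    qed
    ultimately have "?q (Suc j) k \<longlonglongrightarrow> x ^ l * (1 - x) ^ (j - l) * (x / 1)"
      by (rule Lim_transform_eventually)
    then show ?thesis by (simp add: k mult_ac)
  qed
qed

section \<open>Riemann sums with varying summands\<close>

text \<open>The sum divided by \<open>n\<close> is the integral of the step function with value \<open>G n i\<close> on
  \<open>((i-1)/n, i/n]\<close>. At a point \<open>x\<close> this function takes the value \<open>G n i\<close> at \<open>i = \<lceil>x n\<rceil>\<close>, an index
  sequence with \<open>i/n \<longlongrightarrow> x\<close>, so the hypothesis on \<open>G\<close> is pointwise convergence of the step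
  functions inside \<open>(a, c)\<close>, and the bound permits dominated convergence. In contrast to the
  usual theorem on Riemann sums, \<open>G n i\<close> need not be close to \<open>g (i/n)\<close> uniformly in \<open>i\<close>.\<close>
lemma tendsto_step_sum_integral:
  fixes G :: "nat \<Rightarrow> nat \<Rightarrow> real" and g :: "real \<Rightarrow> real" and s u :: "nat \<Rightarrow> nat"
  assumes s: "(\<lambda>n. real (s n) / real n) \<longlonglongrightarrow> a" and u: "(\<lambda>n. real (u n) / real n) \<longlonglongrightarrow> c"
    and ac: "0 \<le> a" "a < c"
    and un: "\<forall>\<^sub>F n in sequentially. u n \<le> n"
    and bd: "\<forall>\<^sub>F n in sequentially. \<forall>i. s n < i \<longrightarrow> i \<le> u n \<longrightarrow> \<bar>G n i\<bar> \<le> B"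
    and lim: "\<And>x i. a < x \<Longrightarrow> x < c \<Longrightarrow> (\<lambda>n. real (i n) / real n) \<longlonglongrightarrow> x \<Longrightarrow> (\<lambda>n. G n (i n)) \<longlonglongrightarrow> g x"
    and g: "continuous_on {a..c} g"
  shows "(\<lambda>n. (\<Sum>i=s n + 1..u n. G n i) / real n) \<longlonglongrightarrow> integral {a..c} g"
proof -
  define I :: "nat \<Rightarrow> nat \<Rightarrow> real set" where "I n i = {(real i - 1) / real n<..real i / real n}" for n i
  define f where "f n x = (\<Sum>i=s n + 1..u n. G n i * indicat_real (I n i) x)" for n x
  obtain N where N: "\<And>n. N \<le> n \<Longrightarrow> 0 < n \<and> u n \<le> n \<and> (\<forall>i. s n < i \<longrightarrow> i \<le> u n \<longrightarrow> \<bar>G n i\<bar> \<le> B)"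
    using eventually_conj[OF eventually_gt_at_top[of 0] eventually_conj[OF un bd]]
    unfolding eventually_sequentially by blast
  define p where "p n x = nat \<lceil>x * real n\<rceil>" for n x
  have mem: "x \<in> I n i \<longleftrightarrow> i = p n x" if "0 < n" "0 < i" for n i x
  proof -
    have "x \<in> I n i \<longleftrightarrow> real i - 1 < x * real n \<and> x * real n \<le> real i"
      using that by (auto simp: I_def field_simps)
    also have "\<dots> \<longleftrightarrow> \<lceil>x * real n\<rceil> = int i"
      by (auto simp: ceiling_eq_iff)
    also have "\<dots> \<longleftrightarrow> i = p n x" using that unfolding p_def by linarith
    finally show ?thesis .
  qed
  have fval: "f n x = (if s n < p n x \<and> p n x \<le> u n then G n (p n x) else 0)" if "0 < n" for n x
  proof -
    have "f n x = (\<Sum>i=s n + 1..u n. if i = p n x then G n i else 0)"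
      unfolding f_def using mem[OF that] by (intro sum.cong) (auto simp: indicator_def)
    then show ?thesis by (simp add: sum.delta Suc_le_eq)
  qed
  have fint: "integral\<^sup>L lborel (f n) = (\<Sum>i=s n + 1..u n. G n i) / real n" if "0 < n" for n
  proof -
    have I: "emeasure lborel (I n i) = ennreal (1 / real n)" for i
      unfolding I_def using that by (simp add: field_simps diff_divide_distrib[symmetric])
    have "I n i \<in> sets lborel" for i by (simp add: I_def)
    then have "integral\<^sup>L lborel (f n) = (\<Sum>i=s n + 1..u n. G n i * measure lborel (I n i))"
      unfolding f_def by (subst Bochner_Integration.integral_sum)
        (auto simp: I intro!: integrable_mult_right integrable_real_indicator)
    then show ?thesis using I by (simp add: measure_def sum_divide_distrib)
  qed
  have pos: "p n x / real n \<le> 1 \<Longrightarrow> x \<le> 1" "s n < p n x \<Longrightarrow> 0 < x" if "0 < n" for n x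
  proof -
    assume "p n x / real n \<le> 1"
    then have "x * real n \<le> real n" using that unfolding p_def by (simp add: field_simps)
    then show "x \<le> 1" using that by (simp add: field_simps)
  next
    assume "s n < p n x"
    then have "0 < \<lceil>x * real n\<rceil>" unfolding p_def by linarith
    then have "0 < x * real n" by simp
    then show "0 < x" using that by (simp add: zero_less_mult_iff)
  qed
  let ?w = "\<lambda>x::real. \<bar>B\<bar> * indicat_real {0..1} x"
  let ?g = "\<lambda>x::real. indicator {a..c} x *\<^sub>R g x"
  have gint: "set_integrable lborel {a..c} g"
    using borel_integrable_atLeastAtMost'[OF g] .
  \<comment> \<open>The index is shifted by \<open>N\<close>, since the bound on \<open>G n\<close> holds only eventually.\<close>
  have "(\<lambda>n. integral\<^sup>L lborel (f (n + N))) \<longlonglongrightarrow> integral\<^sup>L lborel ?g"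
  proof (rule integral_dominated_convergence[where w = ?w])
    show "?g \<in> borel_measurable lborel"
      using gint unfolding set_integrable_def by (rule borel_measurable_integrable)
    show "f (n + N) \<in> borel_measurable lborel" for n
      unfolding f_def I_def by measurable
    show "integrable lborel ?w"
      by (intro integrable_mult_right integrable_real_indicator) auto
    show "AE x in lborel. norm (f (n + N) x) \<le> ?w x" for n
    proof (rule AE_I2)
      fix x
      have n: "0 < n + N" "u (n + N) \<le> n + N" using N[of "n + N"] by auto
      show "norm (f (n + N) x) \<le> ?w x"
      proof (cases "s (n + N) < p (n + N) x \<and> p (n + N) x \<le> u (n + N)")
        case True
        then have "x \<in> {0..1}" using pos[OF n(1), of x] n by (auto simp: field_simps)
        then show ?thesis using N[of "n + N"] True by (force simp: fval[OF n(1)])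
      qed (auto simp: fval[OF n(1)])
    qed
    \<comment> \<open>Nothing is known about the values at the two end points, which form a null set.\<close>
    have "AE x in lborel. x \<noteq> a \<and> x \<noteq> c"
      by (intro AE_conjI AE_lborel_singleton)
    then show "AE x in lborel. (\<lambda>n. f (n + N) x) \<longlonglongrightarrow> ?g x"
    proof eventually_elim
      case (elim x)
      have "(\<lambda>n. f n x) \<longlonglongrightarrow> ?g x"
      proof (cases "0 < x")
        case False
        then have "f n x = 0" if "0 < n" for n using fval[OF that] pos(2)[OF that, of x] by auto
        then have "\<forall>\<^sub>F n in sequentially. f n x = 0"
          using eventually_gt_at_top[of 0] by (rule eventually_mono[rotated]) auto
        moreover have "?g x = 0" using False elim ac by auto
        ultimately show ?thesis by (metis tendsto_eventually)
      next
        case True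
        have p: "(\<lambda>n. real (p n x) / real n) \<longlonglongrightarrow> x"
        proof (rule tendsto_sandwich[where f = "\<lambda>n. x" and h = "\<lambda>n. x + 1 / real n"])
          show "\<forall>\<^sub>F n in sequentially. x \<le> real (p n x) / real n"
            using eventually_gt_at_top[of 0]
            by eventually_elim (simp add: p_def field_simps, linarith)
          show "\<forall>\<^sub>F n in sequentially. real (p n x) / real n \<le> x + 1 / real n"
            using eventually_gt_at_top[of 0]
          proof eventually_elim
            case (elim n)
            have "0 \<le> x * real n" using True by simp
            then have "real (p n x) \<le> x * real n + 1" unfolding p_def by linarith
            then show ?case using elim by (simp add: field_simps)
          qed
          show "(\<lambda>n. x + 1 / real n) \<longlonglongrightarrow> x" by real_asymp
        qed simp
        consider "x < a" | "a < x" "x < c" | "c < x" using elim by linarith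
        then show ?thesis
        proof cases
          case 1
          have "\<forall>\<^sub>F n in sequentially. f n x = 0"
            using eventually_less_of_ratio[OF p s 1] eventually_gt_at_top[of 0]
            by eventually_elim (simp add: fval)
          then show ?thesis using 1 by (simp add: tendsto_eventually)
        next
          case 2
          have "\<forall>\<^sub>F n in sequentially. G n (p n x) = f n x"
            using eventually_less_of_ratio[OF s p 2(1)] eventually_less_of_ratio[OF p u 2(2)]
              eventually_gt_at_top[of 0]
            by eventually_elim (simp add: fval)
          then have "(\<lambda>n. f n x) \<longlonglongrightarrow> g x"
            using lim[OF 2 p] by (rule Lim_transform_eventually[rotated])
          then show ?thesis using 2 by simp
        next
          case 3
          have "\<forall>\<^sub>F n in sequentially. f n x = 0"
            using eventually_less_of_ratio[OF u p 3] eventually_gt_at_top[of 0]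
            by eventually_elim (simp add: fval)
          then show ?thesis using 3 by (simp add: tendsto_eventually)
        qed
      qed
      then show ?case by (rule LIMSEQ_ignore_initial_segment)
    qed
  qed
  then have "(\<lambda>n. integral\<^sup>L lborel (f n)) \<longlonglongrightarrow> integral\<^sup>L lborel ?g"
    by (rule LIMSEQ_offset)
  moreover have "integral\<^sup>L lborel ?g = integral {a..c} g"
    using set_borel_integral_eq_integral(2)[OF gint] unfolding set_lebesgue_integral_def .
  ultimately have "(\<lambda>n. integral\<^sup>L lborel (f n)) \<longlonglongrightarrow> integral {a..c} g"
    by (simp only:)
  moreover have "\<forall>\<^sub>F n in sequentially. integral\<^sup>L lborel (f n) = (\<Sum>i=s n + 1..u n. G n i) / real n"
    using eventually_gt_at_top[of 0] by eventually_elim (rule fint)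
  ultimately show ?thesis by (rule Lim_transform_eventually)
qed

section \<open>The limit of a single phase\<close>

lemma tendsto_rank_kernel:
  fixes u :: "nat \<Rightarrow> nat"
  assumes u: "(\<lambda>n. real (u n) / real n) \<longlonglongrightarrow> x" and x: "0 < x" "x < 1" and "1 \<le> j"
  shows "(\<lambda>n. rank_kernel n (u n) k j) \<longlonglongrightarrow> real ((j - 1) choose (k - 1)) * (x ^ k * (1 - x) ^ (j - k))"
proof (cases "k \<le> j")
  case True
  then show ?thesis
    unfolding rank_kernel_def by (intro tendsto_mult tendsto_const tendsto_choose_ratio[OF u x])
next
  case False
  then have *: "(j - 1) choose (k - 1) = 0" using \<open>1 \<le> j\<close> by (intro binomial_eq_0) simp
  show ?thesis unfolding rank_kernel_def * by simp
qed

text \<open>A crude bound, independent of \<open>n\<close> and \<open>i\<close>, as needed for dominated convergence.\<close>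
lemma rank_kernel_bound:
  assumes "1 \<le> j" "j \<le> n" "k \<le> i"
  shows "\<bar>rank_kernel n i k j\<bar> \<le> real ((j - 1) choose (k - 1))"
proof (cases "k \<le> j")
  case True
  have le: "real ((n - j) choose (i - k)) / real (n choose i) \<le> 1"
    using binomial_shrink[OF True assms(2,3)] by (simp add: divide_le_eq_1) linarith
  then show ?thesis
    unfolding rank_kernel_def using mult_left_le[OF le, of "real ((j - 1) choose (k - 1))"] by simp
next
  case False
  then have *: "(j - 1) choose (k - 1) = 0" using \<open>1 \<le> j\<close> by (intro binomial_eq_0) simp
  show ?thesis unfolding rank_kernel_def * by simp
qed

text \<open>The binomial expansion of \<open>(x + (1 - x)) ^ (j - 1)\<close>, which is complete as \<open>j \<le> r\<close>:
  an object of rank \<open>j \<le> r\<close> has relative rank at most \<open>r\<close> at any time.\<close>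
lemma sum_rank_law:
  fixes x :: real
  assumes "1 \<le> j" "j \<le> r"
  shows "(\<Sum>k=1..r. real ((j-1) choose (k-1)) * x ^ (k-1) * (1 - x) ^ (j-k)) = 1"
proof -
  have "(\<Sum>k=1..r. real ((j-1) choose (k-1)) * x ^ (k-1) * (1 - x) ^ (j-k)) =
      (\<Sum>k<r. real ((j-1) choose k) * x ^ k * (1 - x) ^ (j - 1 - k))"
    by (simp add: sum.atLeast1_atMost_eq)
  also have "\<dots> = (\<Sum>k\<le>j-1. real ((j-1) choose k) * x ^ k * (1 - x) ^ (j - 1 - k))"
    using assms by (intro sum.mono_neutral_right) auto
  also have "\<dots> = (x + (1 - x)) ^ (j - 1)"
    by (rule binomial_ring[symmetric])
  finally show ?thesis by simp
qed

text \<open>The left-hand side is the limit of the double sum of rank kernels; the right-hand side is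
  the form in which it enters the integrand.\<close>
lemma success_density:
  fixes x :: real
  assumes "r \<le> b"
  shows "(\<Sum>k=1..r. \<Sum>j=1..b. real ((j-1) choose (k-1)) * (x ^ k * (1 - x) ^ (j-k))) =
    x * (real r + (\<Sum>j=r+1..b. \<Sum>k=1..r. real ((j-1) choose (k-1)) * x ^ (k-1) * (1 - x) ^ (j-k)))"
proof -
  let ?h = "\<lambda>j k. real ((j-1) choose (k-1)) * x ^ (k-1) * (1 - x) ^ (j-k)"
  have split: "{1..b} = {1..r} \<union> {r+1..b}" using assms by auto
  have "(\<Sum>k=1..r. \<Sum>j=1..b. real ((j-1) choose (k-1)) * (x ^ k * (1 - x) ^ (j-k))) =
      (\<Sum>k=1..r. \<Sum>j=1..b. x * ?h j k)"
  proof (intro sum.cong refl)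
    fix k j assume "k \<in> {1..r}"
    then have "x ^ k = x * x ^ (k - 1)" by (cases k) auto
    then show "real ((j-1) choose (k-1)) * (x ^ k * (1 - x) ^ (j-k)) = x * ?h j k" by simp
  qed
  also have "\<dots> = x * (\<Sum>j=1..b. \<Sum>k=1..r. ?h j k)"
    by (subst sum.swap) (simp add: sum_distrib_left)
  also have "(\<Sum>j=1..b. \<Sum>k=1..r. ?h j k) =
      (\<Sum>j=1..r. \<Sum>k=1..r. ?h j k) + (\<Sum>j=r+1..b. \<Sum>k=1..r. ?h j k)"
    unfolding split by (intro sum.union_disjoint) auto
  also have "(\<Sum>j=1..r. \<Sum>k=1..r. ?h j k) = real r"
  proof -
    have "(\<Sum>j=1..r. \<Sum>k=1..r. ?h j k) = (\<Sum>j=1..r. 1)"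
      by (intro sum.cong sum_rank_law refl) auto
    then show ?thesis by simp
  qed
  finally show ?thesis .
qed

text \<open>The probability of stopping in \<open>{s+1..u}\<close> with a winning object, for the policy that picks
  the first relative rank \<open>\<le> r\<close> after position \<open>s\<close>.\<close>
definition phase_sum :: "nat \<Rightarrow> nat \<Rightarrow> nat \<Rightarrow> nat \<Rightarrow> nat \<Rightarrow> real" where
  "phase_sum n b r s u = (\<Sum>i=s+1..u. (\<Prod>m=s+1..i-1. real (m - r) / real m) / real i *
     (\<Sum>k=1..r. \<Sum>j=1..b. rank_kernel n i k j))"

lemma tendsto_phase_sum:
  fixes s u :: "nat \<Rightarrow> nat"
  assumes s: "(\<lambda>n. real (s n) / real n) \<longlonglongrightarrow> a" and u: "(\<lambda>n. real (u n) / real n) \<longlonglongrightarrow> c"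
    and ac: "0 < a" "a < c" "c \<le> 1" and un: "\<forall>\<^sub>F n in sequentially. u n \<le> n" and "r \<le> b"
  shows "(\<lambda>n. phase_sum n b r (s n) (u n)) \<longlonglongrightarrow>
    a ^ r * integral {a..c} (\<lambda>x. 1 / x ^ r *
        (real r + (\<Sum>j=r+1..b. \<Sum>k=1..r. real ((j-1) choose (k-1)) * x ^ (k-1) * (1 - x) ^ (j-k))))"
proof -
  define h where "h x = 1 / x ^ r *
        (real r + (\<Sum>j=r+1..b. \<Sum>k=1..r. real ((j-1) choose (k-1)) * x ^ (k-1) * (1 - x) ^ (j-k)))"
    for x :: real
  define S where "S n i = (\<Prod>m=s n+1..i-1. real (m - r) / real m)" for n i
  define K where "K n i = (\<Sum>k=1..r. \<Sum>j=1..b. rank_kernel n i k j)" for n i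
  define C where "C = (\<Sum>k=1..r. \<Sum>j=1..b. real ((j - 1) choose (k - 1)))"
  \<comment> \<open>The factor \<open>n\<close> compensates the normalisation of the Riemann sum; \<open>n/i\<close> stays bounded since
    eventually \<open>i > s n \<ge> n a/2\<close>.\<close>
  let ?G = "\<lambda>n i. real n / real i * S n i * K n i"
  have "(\<lambda>n. (\<Sum>i=s n + 1..u n. ?G n i) / real n) \<longlonglongrightarrow> integral {a..c} (\<lambda>x. a ^ r * h x)"
  proof (rule tendsto_step_sum_integral[OF s u])
    show "0 \<le> a" "a < c" using ac by auto
    show "\<forall>\<^sub>F n in sequentially. u n \<le> n" by (rule un)
    have "\<forall>\<^sub>F n in sequentially. a / 2 < real (s n) / real n"
      using ac by (intro order_tendstoD(1)[OF s]) auto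
    then show "\<forall>\<^sub>F n in sequentially. \<forall>i. s n < i \<longrightarrow> i \<le> u n \<longrightarrow> \<bar>?G n i\<bar> \<le> 2 / a * 1 * C"
      using eventually_gt_const[OF s \<open>0 < a\<close>, of r] eventually_ge_at_top[of b] eventually_gt_at_top[of 0]
    proof (eventually_elim, intro allI impI)
      case (elim n)
      fix i assume i: "s n < i" "i \<le> u n"
      have "a * real n \<le> 2 * real (s n)" using elim by (simp add: field_simps)
      then have "a * real n \<le> 2 * real i" using i by linarith
      then have "\<bar>real n / real i\<bar> \<le> 2 / a" using i ac by (simp add: field_simps)
      moreover have "0 \<le> S n i" "S n i \<le> 1"
        unfolding S_def by (auto intro!: prod_nonneg prod_le_1)
      then have "\<bar>S n i\<bar> \<le> 1" by simp
      moreover have "\<bar>K n i\<bar> \<le> C"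
        unfolding K_def C_def using elim i
        by (intro order_trans[OF sum_abs] sum_mono rank_kernel_bound) auto
      ultimately show "\<bar>?G n i\<bar> \<le> 2 / a * 1 * C"
        unfolding abs_mult using ac by (intro mult_mono mult_nonneg_nonneg) auto
    qed
    show "(\<lambda>n. ?G n (i n)) \<longlonglongrightarrow> a ^ r * h x"
      if x: "a < x" "x < c" and i: "(\<lambda>n. real (i n) / real n) \<longlonglongrightarrow> x" for x i
    proof -
      have x': "0 < x" "x < 1" using x ac by auto
      have one: "(\<lambda>n. real n / real n) \<longlonglongrightarrow> 1" by real_asymp
      have "(\<lambda>n. real (i n) / real n - 1 / real n) \<longlonglongrightarrow> x - 0"
        by (intro tendsto_diff i lim_1_over_n)
      moreover have "\<forall>\<^sub>F n in sequentially. real (i n) / real n - 1 / real n = real (i n - 1) / real n"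
        using eventually_gt_const[OF i x'(1), of 0]
        by eventually_elim (simp add: of_nat_diff diff_divide_distrib)
      ultimately have "(\<lambda>n. real (i n - 1) / real n) \<longlonglongrightarrow> x - 0"
        by (rule Lim_transform_eventually)
      then have "(\<lambda>n. S n (i n)) \<longlonglongrightarrow> (a / x) ^ r"
        unfolding S_def using x ac by (intro tendsto_survival_prod[OF s]) auto
      moreover have "(\<lambda>n. K n (i n)) \<longlonglongrightarrow>
          (\<Sum>k=1..r. \<Sum>j=1..b. real ((j-1) choose (k-1)) * (x ^ k * (1 - x) ^ (j-k)))"
        unfolding K_def by (intro tendsto_sum tendsto_rank_kernel[OF i x']) auto
      moreover have "(\<lambda>n. real n / real (i n)) \<longlonglongrightarrow> 1 / x"
        using tendsto_shifted_ratio[OF one i, of 0 0] x' by simp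
      ultimately have "(\<lambda>n. ?G n (i n)) \<longlonglongrightarrow> 1 / x * (a / x) ^ r *
          (\<Sum>k=1..r. \<Sum>j=1..b. real ((j-1) choose (k-1)) * (x ^ k * (1 - x) ^ (j-k)))"
        by (intro tendsto_mult)
      then show ?thesis
        unfolding success_density[OF \<open>r \<le> b\<close>] h_def using x' by (simp add: power_divide)
    qed
    show "continuous_on {a..c} (\<lambda>x. a ^ r * h x)"
      unfolding h_def using ac by (intro continuous_intros) auto
  qed
  moreover have "\<forall>\<^sub>F n in sequentially. (\<Sum>i=s n + 1..u n. ?G n i) / real n = phase_sum n b r (s n) (u n)"
    using eventually_gt_at_top[of 0]
    by eventually_elim (simp add: phase_sum_def S_def K_def sum_divide_distrib)
  ultimately have "(\<lambda>n. phase_sum n b r (s n) (u n)) \<longlonglongrightarrow> integral {a..c} (\<lambda>x. a ^ r * h x)"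
    by (rule Lim_transform_eventually)
  then show ?thesis unfolding integral_mult_right h_def .
qed

section \<open>Decomposition of the winning probability\<close>

definition dlp_level :: "nat \<times> nat \<Rightarrow> nat \<times> nat \<Rightarrow> nat \<Rightarrow> nat" where
  "dlp_level s r m = (if m \<le> fst s then 0 else if m \<le> snd s then fst r else snd r)"

text \<open>The double-level policy is the threshold policy with levels \<open>dlp_level\<close>, forced to stop at
  \<open>n\<close>. The picked position satisfies the stopping condition, and at most one position does: the
  earlier one of two would contradict that the later one has been reached unstopped.\<close>
lemma dlp_pick_eq_iff:
  assumes s: "fst s < snd s" "snd s < n" and i: "i \<in> {1..n}"
  shows "dlp_pick n s r X = i \<longleftrightarrow>
    unstopped (dlp_level s r) (i - 1) X \<and> (i < n \<longrightarrow> rel_rank X i \<le> dlp_level s r i)"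
    and "dlp_pick n s r X \<in> {1..n}"
proof -
  let ?t = "dlp_level s r"
  let ?stop = "\<lambda>p. p \<in> {1..n} \<and> unstopped ?t (p - 1) X \<and> (p < n \<longrightarrow> rel_rank X p \<le> ?t p)"
  have start: "?t m < rel_rank X m" if "m \<in> {1..fst s}" for m
    using that rel_rank_bounds[of m X] by (simp add: dlp_level_def)
  let ?P = "\<lambda>i. i \<in> {fst s + 1..snd s} \<and> rel_rank X i \<le> fst r"
  let ?Q = "\<lambda>i. i \<in> {snd s + 1..n - 1} \<and> rel_rank X i \<le> snd r"
  have first: "?t m < rel_rank X m" if "m \<in> {1..snd s}" "\<not> ?P m" for m
  proof (cases "m \<le> fst s")
    case True
    then show ?thesis using start[of m] that(1) by simp
  next
    case False
    then have "?t m = fst r" using that(1) by (simp add: dlp_level_def)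
    then show ?thesis using False that by simp
  qed
  have stop: "?stop (dlp_pick n s r X)"
  proof (cases "\<exists>i. ?P i")
    case True
    define p where "p = (LEAST i. ?P i)"
    have p: "?P p" using True unfolding p_def by (rule LeastI_ex)
    have minimal: "\<not> ?P m" if "m < p" for m
      using that unfolding p_def by (rule not_less_Least)
    have "?t m < rel_rank X m" if "m \<in> {1..p - 1}" for m
    proof (rule first)
      show "m \<in> {1..snd s}" using that p by simp linarith
      show "\<not> ?P m" using that by (intro minimal) auto
    qed
    then have "unstopped ?t (p - 1) X" by (simp add: unstopped_def)
    moreover have "?t p = fst r" "p \<in> {1..n}" using p s by (auto simp: dlp_level_def)
    moreover have "dlp_pick n s r X = p"
      using True unfolding dlp_pick_def p_def by (simp add: Bex_def)
    ultimately show ?thesis using p by simp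
  next
    case notP: False
    have second: "?t m < rel_rank X m" if "m \<in> {1..n - 1}" "\<not> ?Q m" for m
    proof (cases "m \<le> snd s")
      case True
      then show ?thesis using first[of m] notP that(1) by simp
    next
      case False
      then have "?t m = snd r" using s by (simp add: dlp_level_def)
      then show ?thesis using False that by simp
    qed
    show ?thesis
    proof (cases "\<exists>i. ?Q i")
      case True
      define p where "p = (LEAST i. ?Q i)"
      have p: "?Q p" using True unfolding p_def by (rule LeastI_ex)
      have minimal: "\<not> ?Q m" if "m < p" for m
        using that unfolding p_def by (rule not_less_Least)
      have "?t m < rel_rank X m" if "m \<in> {1..p - 1}" for m
      proof (rule second)
        show "m \<in> {1..n - 1}" using that p by simp linarith
        show "\<not> ?Q m" using that by (intro minimal) auto
      qed
      then have "unstopped ?t (p - 1) X" by (simp add: unstopped_def)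
      moreover have "?t p = snd r" "p \<in> {1..n}" using p s by (auto simp: dlp_level_def)
      moreover have "dlp_pick n s r X = p"
        using True notP unfolding dlp_pick_def p_def by (simp add: Bex_def)
      ultimately show ?thesis using p by simp
    next
      case False
      have "?t m < rel_rank X m" if "m \<in> {1..n - 1}" for m
        using second[OF that] False by blast
      then have "unstopped ?t (n - 1) X" by (simp add: unstopped_def)
      moreover have "dlp_pick n s r X = n"
        using False notP unfolding dlp_pick_def by (simp add: Bex_def)
      ultimately show ?thesis using s by simp
    qed
  qed
  then show "dlp_pick n s r X \<in> {1..n}" by blast
  have "\<not> p < q" if p: "?stop p" and q: "?stop q" for p q
  proof
    assume "p < q"
    then have "p \<in> {1..q - 1}" "p < n" using p q by auto
    then show False using p q unfolding unstopped_def by fastforce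
  qed
  then have "p = q" if "?stop p" "?stop q" for p q
    using that by (meson linorder_neqE_nat)
  then show "dlp_pick n s r X = i \<longleftrightarrow>
      unstopped ?t (i - 1) X \<and> (i < n \<longrightarrow> rel_rank X i \<le> ?t i)"
    using stop i by blast
qed

lemma prob_last_le:
  assumes "b \<le> n" "0 < n"
  shows "perm_prob n (\<lambda>X. X n \<le> b) = real b / real n"
proof -
  obtain l where l: "n = Suc l" using assms by (cases n) auto
  have "perm_prob l (\<lambda>p. (insert_rank l y \<circ> p) (Suc l) \<le> b) = of_bool (y \<le> b)" if "y \<in> {1..Suc l}" for y
  proof -
    have "perm_prob l (\<lambda>p. (insert_rank l y \<circ> p) (Suc l) \<le> b) = perm_prob l (\<lambda>p. y \<le> b)"
      using insert_rank_last(1)[OF _ that] by (intro perm_prob_cong) simp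
    then show ?thesis by (cases "y \<le> b") (simp_all add: perm_prob_True perm_prob_False)
  qed
  then have "perm_prob n (\<lambda>X. X n \<le> b) = (\<Sum>y=1..n. of_bool (y \<le> b)) / real n"
    unfolding l perm_prob_Suc by (intro arg_cong2[where f = "(/)"] sum.cong) auto
  also have "(\<Sum>y=1..n. of_bool (y \<le> b)) = real (card ({1..n} \<inter> {y. y \<le> b}))" by simp
  also have "{1..n} \<inter> {y. y \<le> b} = {1..b}" using assms by auto
  finally show ?thesis by simp
qed

lemma prob_stop_and_win:
  assumes "1 \<le> i" "i \<le> n" "b \<le> n" "t i \<le> i"
  shows "perm_prob n (\<lambda>X. (unstopped t (i - 1) X \<and> rel_rank X i \<le> t i) \<and> X i \<le> b) =
    (\<Prod>m=1..i-1. real (m - t m) / real m) / real i * (\<Sum>k=1..t i. \<Sum>j=1..b. rank_kernel n i k j)"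
proof -
  let ?P = "\<lambda>X. (unstopped t (i - 1) X \<and> rel_rank X i \<le> t i) \<and> X i \<le> b"
  let ?c = "(\<Prod>m=1..i-1. real (m - t m) / real m) / real i"
  have "perm_prob n ?P = (\<Sum>p\<in>{1..t i} \<times> {1..b}. perm_prob n (\<lambda>X. ?P X \<and> (rel_rank X i, X i) = p))"
  proof (rule perm_prob_partition)
    fix X assume X: "X permutes {1..n}" "?P X"
    have "X i \<in> {1..n}" using permutes_in_image[OF X(1), of i] assms by simp
    then show "(rel_rank X i, X i) \<in> {1..t i} \<times> {1..b}"
      using X rel_rank_bounds[of i X] assms by simp
  qed simp
  also have "\<dots> = (\<Sum>(k, j)\<in>{1..t i} \<times> {1..b}. ?c * rank_kernel n i k j)"
  proof (intro sum.cong refl, clarify)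
    fix k j assume kj: "k \<in> {1..t i}" "j \<in> {1..b}"
    have "perm_prob n (\<lambda>X. ?P X \<and> (rel_rank X i, X i) = (k, j)) =
        perm_prob n (\<lambda>X. (unstopped t (i - 1) X \<and> rel_rank X i = k) \<and> X i = j)"
      using kj by (intro perm_prob_cong) auto
    then show "perm_prob n (\<lambda>X. ?P X \<and> (rel_rank X i, X i) = (k, j)) = ?c * rank_kernel n i k j"
      using prob_stop_with_rank[of k i n j t] kj assms by simp
  qed
  also have "\<dots> = (\<Sum>k=1..t i. \<Sum>j=1..b. ?c * rank_kernel n i k j)"
    by (rule sum.cartesian_product[symmetric])
  finally show ?thesis by (simp add: sum_distrib_left)
qed

text \<open>The error term is the contribution of the forced pick at \<open>n\<close>. Reaching a position of the
  second phase requires surviving the whole first phase, which factors out.\<close>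
lemma dlp_win_prob_phases:
  assumes r: "r1 \<le> s1" "r2 \<le> s2" and s: "s1 < s2" "s2 < n" and b: "b \<le> n"
  shows "\<bar>dlp_win_prob b n (s1, s2) (r1, r2) - (phase_sum n b r1 s1 s2 +
    (\<Prod>m=s1+1..s2. real (m - r1) / real m) * phase_sum n b r2 s2 (n - 1))\<bar> \<le> real b / real n"
proof -
  let ?t = "dlp_level (s1, s2) (r1, r2)"
  let ?pick = "dlp_pick n (s1, s2) (r1, r2)"
  let ?w = "\<lambda>i. perm_prob n (\<lambda>X. X (?pick X) \<le> b \<and> ?pick X = i)"
  let ?V = "\<lambda>i. (\<Prod>m=1..i-1. real (m - ?t m) / real m) / real i * (\<Sum>k=1..?t i. \<Sum>j=1..b. rank_kernel n i k j)"
  have t_le: "?t i \<le> i" for i using r s by (simp add: dlp_level_def)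
  have w: "?w i = ?V i" if "i \<in> {1..n - 1}" for i
  proof -
    have "i \<in> {1..n}" "i < n" using that by auto
    then have "?pick X = i \<longleftrightarrow> unstopped ?t (i - 1) X \<and> rel_rank X i \<le> ?t i" for X
      using dlp_pick_eq_iff(1)[of "(s1, s2)" n i "(r1, r2)"] s by simp
    then have "?w i = perm_prob n (\<lambda>X. (unstopped ?t (i - 1) X \<and> rel_rank X i \<le> ?t i) \<and> X i \<le> b)"
      by (intro perm_prob_cong) metis
    then show ?thesis
      using prob_stop_and_win[of i n b ?t] \<open>i \<in> {1..n}\<close> b t_le[of i] by simp
  qed
  have "dlp_win_prob b n (s1, s2) (r1, r2) = (\<Sum>i\<in>{1..n}. ?w i)"
    unfolding dlp_win_prob_def prob_eq_perm_prob
    using dlp_pick_eq_iff(2)[of "(s1, s2)" n n "(r1, r2)"] s by (intro perm_prob_partition) auto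
  also have "{1..n} = insert n ({1..s1} \<union> {s1+1..s2} \<union> {s2+1..n-1})" using s by auto
  also have "sum ?w \<dots> = ?w n + (sum ?w {1..s1} + sum ?w {s1+1..s2} + sum ?w {s2+1..n-1})"
    using s by (simp add: sum.union_disjoint ivl_disj_int disjoint_iff)
  also have "sum ?w {1..s1} = 0"
  proof (rule sum.neutral, rule ballI)
    fix i assume i: "i \<in> {1..s1}"
    have "?t i = 0" using i by (simp add: dlp_level_def)
    moreover have "i \<in> {1..n-1}" using i s by auto
    ultimately show "?w i = 0" using w[of i] by simp
  qed
  also have "sum ?w {s1+1..s2} = phase_sum n b r1 s1 s2"
    unfolding phase_sum_def
  proof (rule sum.cong[OF refl])
    fix i assume i: "i \<in> {s1+1..s2}"
    then have iin: "i \<in> {1..n-1}" using s by auto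
    have "(\<Prod>m=1..i-1. real (m - ?t m) / real m) = (\<Prod>m=s1+1..i-1. real (m - r1) / real m)"
      using i by (intro prod.mono_neutral_cong_right) (auto simp: dlp_level_def)
    moreover have "?t i = r1" using i by (simp add: dlp_level_def)
    ultimately show "?w i = (\<Prod>m=s1+1..i-1. real (m - r1) / real m) / real i *
        (\<Sum>k=1..r1. \<Sum>j=1..b. rank_kernel n i k j)"
      using w[OF iin] by simp
  qed
  also have "sum ?w {s2+1..n-1} =
      (\<Prod>m=s1+1..s2. real (m - r1) / real m) * phase_sum n b r2 s2 (n - 1)"
    unfolding phase_sum_def sum_distrib_left[where A = "{s2+1..n-1}"]
  proof (rule sum.cong[OF refl])
    fix i assume i: "i \<in> {s2+1..n-1}"
    then have iin: "i \<in> {1..n-1}" using s by auto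
    have "(\<Prod>m=1..i-1. real (m - ?t m) / real m) = (\<Prod>m\<in>{s1+1..s2} \<union> {s2+1..i-1}. real (m - ?t m) / real m)"
      using i s by (intro prod.mono_neutral_cong_right) (auto simp: dlp_level_def)
    also have "\<dots> = (\<Prod>m=s1+1..s2. real (m - ?t m) / real m) * (\<Prod>m=s2+1..i-1. real (m - ?t m) / real m)"
      by (intro prod.union_disjoint) auto
    also have "(\<Prod>m=s1+1..s2. real (m - ?t m) / real m) = (\<Prod>m=s1+1..s2. real (m - r1) / real m)"
      by (intro prod.cong) (auto simp: dlp_level_def)
    also have "(\<Prod>m=s2+1..i-1. real (m - ?t m) / real m) = (\<Prod>m=s2+1..i-1. real (m - r2) / real m)"
      using s by (intro prod.cong) (auto simp: dlp_level_def)
    finally have "(\<Prod>m=1..i-1. real (m - ?t m) / real m) =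
      (\<Prod>m=s1+1..s2. real (m - r1) / real m) * (\<Prod>m=s2+1..i-1. real (m - r2) / real m)" .
    moreover have "?t i = r2" using i s by (simp add: dlp_level_def)
    ultimately show "?w i = (\<Prod>m=s1+1..s2. real (m - r1) / real m) *
        ((\<Prod>m=s2+1..i-1. real (m - r2) / real m) / real i * (\<Sum>k=1..r2. \<Sum>j=1..b. rank_kernel n i k j))"
      using w[OF iin] by simp
  qed
  finally have "dlp_win_prob b n (s1, s2) (r1, r2) - (phase_sum n b r1 s1 s2 +
    (\<Prod>m=s1+1..s2. real (m - r1) / real m) * phase_sum n b r2 s2 (n - 1)) = ?w n" by simp
  moreover have "?w n \<le> perm_prob n (\<lambda>X. X n \<le> b)" by (rule perm_prob_mono) auto
  ultimately show ?thesis
    using prob_last_le[of b n] perm_prob_nonneg[of n "\<lambda>X. X (?pick X) \<le> b \<and> ?pick X = n"] b s by simp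
qed

lemma tendsto_ratio_of_smallo:
  assumes "(\<lambda>n. real (s n) - a * real n) \<in> o(\<lambda>n. real n)"
  shows "(\<lambda>n. real (s n) / real n) \<longlonglongrightarrow> a"
proof -
  have "(\<lambda>n. (real (s n) - a * real n) / real n + a) \<longlonglongrightarrow> 0 + a"
    by (intro tendsto_add smalloD_tendsto[OF assms] tendsto_const)
  moreover have "\<forall>\<^sub>F n in sequentially. (real (s n) - a * real n) / real n + a = real (s n) / real n"
    using eventually_gt_at_top[of 0] by eventually_elim (simp add: field_simps)
  ultimately show ?thesis by (simp add: Lim_transform_eventually)
qed

theorem theorem6:
  fixes b r1 r2 :: nat and \<alpha>1 \<alpha>2 :: real and s1 s2 :: "nat \<Rightarrow> nat"
  assumes "1 \<le> r1" and "r1 < r2" and "r2 \<le> b"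
    and "0 < \<alpha>1" and "\<alpha>1 < \<alpha>2" and "\<alpha>2 < 1"
    and "(\<lambda>n. real (s1 n) - \<alpha>1 * real n) \<in> o(\<lambda>n. real n)"
    and "(\<lambda>n. real (s2 n) - \<alpha>2 * real n) \<in> o(\<lambda>n. real n)"
  shows "(\<lambda>n. dlp_win_prob b n (s1 n, s2 n) (r1, r2)) \<longlonglongrightarrow>
      \<alpha>1 ^ r1 * integral {\<alpha>1..\<alpha>2} (\<lambda>x. 1 / x ^ r1 *
        (real r1 + (\<Sum>j=r1+1..b. \<Sum>k=1..r1. real ((j-1) choose (k-1)) * x ^ (k-1) * (1 - x) ^ (j-k))))
    + \<alpha>1 ^ r1 * \<alpha>2 ^ (r2 - r1) * integral {\<alpha>2..1} (\<lambda>x. 1 / x ^ r2 *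
        (real r2 + (\<Sum>j=r2+1..b. \<Sum>k=1..r2. real ((j-1) choose (k-1)) * x ^ (k-1) * (1 - x) ^ (j-k))))"
proof -
  note s1 = tendsto_ratio_of_smallo[OF assms(7)] and s2 = tendsto_ratio_of_smallo[OF assms(8)]
  have last: "(\<lambda>n. real (n - 1) / real n) \<longlonglongrightarrow> 1" by real_asymp
  have "0 < \<alpha>2" using assms by simp
  let ?D = "\<lambda>n. \<Prod>m=s1 n+1..s2 n. real (m - r1) / real m"
  let ?I1 = "integral {\<alpha>1..\<alpha>2} (\<lambda>x. 1 / x ^ r1 *
        (real r1 + (\<Sum>j=r1+1..b. \<Sum>k=1..r1. real ((j-1) choose (k-1)) * x ^ (k-1) * (1 - x) ^ (j-k))))"
  let ?I2 = "integral {\<alpha>2..1} (\<lambda>x. 1 / x ^ r2 *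
        (real r2 + (\<Sum>j=r2+1..b. \<Sum>k=1..r2. real ((j-1) choose (k-1)) * x ^ (k-1) * (1 - x) ^ (j-k))))"
  let ?A = "\<lambda>n. phase_sum n b r1 (s1 n) (s2 n) + ?D n * phase_sum n b r2 (s2 n) (n - 1)"
  have lt: "\<forall>\<^sub>F n in sequentially. s2 n < n - 1"
    using eventually_less_of_ratio[OF s2 last \<open>\<alpha>2 < 1\<close>] .
  have "\<forall>\<^sub>F n in sequentially. s2 n \<le> n" using lt by eventually_elim simp
  then have phase1: "(\<lambda>n. phase_sum n b r1 (s1 n) (s2 n)) \<longlonglongrightarrow> \<alpha>1 ^ r1 * ?I1"
    using assms by (intro tendsto_phase_sum[OF s1 s2]) auto
  have phase2: "(\<lambda>n. phase_sum n b r2 (s2 n) (n - 1)) \<longlonglongrightarrow> \<alpha>2 ^ r2 * ?I2"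
    using assms \<open>0 < \<alpha>2\<close> by (intro tendsto_phase_sum[OF s2 last]) auto
  have survive: "?D \<longlonglongrightarrow> (\<alpha>1 / \<alpha>2) ^ r1"
    using assms by (intro tendsto_survival_prod[OF s1 s2]) auto
  have "(\<lambda>n. dlp_win_prob b n (s1 n, s2 n) (r1, r2) - ?A n) \<longlonglongrightarrow> 0"
  proof (rule Lim_null_comparison)
    show "\<forall>\<^sub>F n in sequentially. norm (dlp_win_prob b n (s1 n, s2 n) (r1, r2) - ?A n) \<le> real b / real n"
      using lt eventually_less_of_ratio[OF s1 s2 \<open>\<alpha>1 < \<alpha>2\<close>]
        eventually_gt_const[OF s1 \<open>0 < \<alpha>1\<close>, of r1] eventually_gt_const[OF s2 \<open>0 < \<alpha>2\<close>, of r2]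
        eventually_ge_at_top[of b]
      by eventually_elim (unfold real_norm_def, rule dlp_win_prob_phases, auto)
    show "(\<lambda>n. real b / real n) \<longlonglongrightarrow> 0" by real_asymp
  qed
  from tendsto_add[OF this tendsto_add[OF phase1 tendsto_mult[OF survive phase2]]]
  have lim: "(\<lambda>n. dlp_win_prob b n (s1 n, s2 n) (r1, r2)) \<longlonglongrightarrow>
      \<alpha>1 ^ r1 * ?I1 + (\<alpha>1 / \<alpha>2) ^ r1 * (\<alpha>2 ^ r2 * ?I2)"
    by (simp only: diff_add_cancel add_0)
  have const:  "(\<alpha>1 / \<alpha>2) ^ r1 * (\<alpha>2 ^ r2 * ?I2) = \<alpha>1 ^ r1 * \<alpha>2 ^ (r2 - r1) * ?I2"
    using \<open>0 < \<alpha>2\<close> \<open>r1 < r2\<close> by (simp add: power_divide power_diff)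
  show ?thesis using lim unfolding const .
qed

end
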